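(* Let $q$ be an odd prime power with $q\equiv1\pmod 4$ and $\ell>1$ an odd integer. Let $\omega\in\mathbb{F}_{q^2}\setminus\mathbb{F}_q$ with $\omega^q=-\omega$, put $\sigma=\omega^2$, and let $\bar\beta\in\mathbb{F}_{q^2}$ with $\bar\beta^{q+1}=\sigma^{-1}$. Then the commutative presemifields $P(q,\ell)$ and $\overline{B}(q,\ell,2,\bar\beta)$ are strongly isotopic.
   Context: Write $\ell=2k+1$. $P(q,\ell)=(\mathbb{F}_{q^{2\ell}},+,* )$ with $x*y=\tfrac12(xy+x^{q^\ell}y^{q^\ell})+\tfrac14G(xy^{q^2}+x^{q^2}y)$, where $G(x)=\sum_{i=1}^{k}(-1)^i(x-x^{q^\ell})^{q^{2i}}+\sum_{j=1}^{k-1}(-1)^{k+j}(x-x^{q^\ell})^{q^{2j+1}}$. $\overline{B}(q,\ell,2,\bar\beta)=(\mathbb{F}_{q^{2\ell}},+,\star)$ with $x\star y=xy^{q^\ell}+x^{q^\ell}y+[\bar\beta(xy^{q^2}+x^{q^2}y)+\bar\beta^{q^\ell}(xy^{q^2}+x^{q^2}y)^{q^\ell}]\omega$. Two presemifields $(\mathbb{F},+,\bullet)$, $(\mathbb{F},+,\star)$ of characteristic $p$ are strongly isotopic if there exist $\mathbb{F}_p$-linear permutations $M,L$ of $\mathbb{F}$ with $M(x)\star M(y)=L(x\bullet y)$ for all $x,y$.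
   Formalization: With the sums in G starting at 1 as printed, P(q,ℓ) need not be a presemifield (e.g. q=5, ℓ=31); the theorem is proved outright with both sums starting at 0, and for the printed G under the hypothesis that P(q,ℓ) is a commutative presemifield. *)

theory Defs
  imports "HOL-Number_Theory.Number_Theory"
begin

text \<open>
  The ambient field \<open>F\<close> of order \<open>q^(2 l)\<close> is a type of class field and finite; a (pre)semifield
  structure on its additive group is given by its multiplication alone. Subfields are sets of
  fixed points of a power of the Frobenius map.
\<close>

definition subfield_of_order :: "nat \<Rightarrow> 'a::field set" where
  "subfield_of_order r = {x. x ^ r = x}"

definition presemifield :: "('a::field \<Rightarrow> 'a \<Rightarrow> 'a) \<Rightarrow> bool" where
  "presemifield m \<longleftrightarrow>
     (\<forall>x y z. m x (y + z) = m x y + m x z) \<and>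
     (\<forall>x y z. m (x + y) z = m x z + m y z) \<and>
     (\<forall>x y. m x y = 0 \<longrightarrow> x = 0 \<or> y = 0)"

definition commutative_presemifield :: "('a::field \<Rightarrow> 'a \<Rightarrow> 'a) \<Rightarrow> bool" where
  "commutative_presemifield m \<longleftrightarrow> presemifield m \<and> (\<forall>x y. m x y = m y x)"

text \<open>The prime field \<open>F_p\<close> of a field of characteristic \<open>p\<close> is the image of \<open>of_int\<close>.\<close>

definition prime_field_linear :: "('a::field \<Rightarrow> 'a) \<Rightarrow> bool" where
  "prime_field_linear f \<longleftrightarrow>
     (\<forall>x y. f (x + y) = f x + f y) \<and> (\<forall>c x. f (of_int c * x) = of_int c * f x)"

definition strongly_isotopic :: "('a::field \<Rightarrow> 'a \<Rightarrow> 'a) \<Rightarrow> ('a \<Rightarrow> 'a \<Rightarrow> 'a) \<Rightarrow> bool" where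
  "strongly_isotopic m m' \<longleftrightarrow>
     (\<exists>M L. prime_field_linear M \<and> bij M \<and> prime_field_linear L \<and> bij L \<and>
            (\<forall>x y. m' (M x) (M y) = L (m x y)))"

text \<open>
  Here \<open>l = 2 k + 1\<close>. The parameter \<open>s\<close> is the lower limit of both sums. With \<open>s = 0\<close> this is the
  function for which \<open>P_mult\<close> is a commutative semifield with identity \<open>1\<close>: on the elements \<open>u\<close> with
  \<open>u^(q^l) = -u\<close> the sums then invert \<open>u \<mapsto> (u + u^(q^2)) / 2\<close>. With \<open>s = 1\<close> the sums can be
  singular on these elements (for instance for \<open>q = 5\<close>, \<open>l = 31\<close> and for \<open>q = 49\<close>, \<open>l = 9\<close>), and then
  \<open>P_mult\<close> is not a presemifield.
\<close>

definition P_fun :: "nat \<Rightarrow> nat \<Rightarrow> nat \<Rightarrow> 'a::field \<Rightarrow> 'a" where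
  "P_fun s q l x =
     (let k = (l - 1) div 2 in
        (\<Sum>i = s..k. (- 1) ^ i * (x - x ^ (q ^ l)) ^ (q ^ (2 * i))) +
        (\<Sum>j = s..k - 1. (- 1) ^ (k + j) * (x - x ^ (q ^ l)) ^ (q ^ (2 * j + 1))))"

definition P_mult :: "nat \<Rightarrow> nat \<Rightarrow> nat \<Rightarrow> 'a::field \<Rightarrow> 'a \<Rightarrow> 'a" where
  "P_mult s q l x y =
     1 / 2 * (x * y + x ^ (q ^ l) * y ^ (q ^ l)) +
     1 / 4 * P_fun s q l (x * y ^ (q ^ 2) + x ^ (q ^ 2) * y)"

definition B_mult :: "nat \<Rightarrow> nat \<Rightarrow> nat \<Rightarrow> 'a::field \<Rightarrow> 'a \<Rightarrow> 'a \<Rightarrow> 'a \<Rightarrow> 'a" where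
  "B_mult q l d \<omega> \<beta> x y =
     x * y ^ (q ^ l) + x ^ (q ^ l) * y +
     (\<beta> * (x * y ^ (q ^ d) + x ^ (q ^ d) * y) +
      \<beta> ^ (q ^ l) * (x * y ^ (q ^ d) + x ^ (q ^ d) * y) ^ (q ^ l)) * \<omega>"

end

theory Submission
  imports Defs "HOL-Computational_Algebra.Polynomial"
begin

text \<open>
  Write \<open>bar x = x^(q^l)\<close>, \<open>tau x = x^(q^2)\<close> and \<open>A(x, y) = x * tau y + tau x * y\<close>.
  Since \<open>q mod 4 = 1\<close>, there are \<open>i\<close> in the field of order \<open>q\<close> with \<open>i^2 = - 1\<close> and \<open>c\<close> in the
  field of order \<open>q^2\<close> with \<open>c^2 = 1 / (\<beta> * \<omega>)\<close>: the norm of \<open>1 / (\<beta> * \<omega>)\<close> is the square \<open>- 1\<close>.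
  With \<open>M x = c * (x + i * bar x)\<close> one gets
  \<open>M x \<star> M y = 2 * i * c * bar c * (x * y + bar (x * y)) + 2 * (A(x, y) - bar (A(x, y)))\<close>,
  and an additive map sends this to the product of \<open>x\<close> and \<open>y\<close> in \<open>P(q, l)\<close>. There are no zero
  divisors, as \<open>x * y + bar (x * y) = 0\<close> and \<open>A(x, y) = bar (A(x, y))\<close> force \<open>x = 0\<close> or \<open>y = 0\<close>;
  for \<open>P(q, l)\<close> this uses that \<open>u \<mapsto> u + tau u\<close> inverts the sums starting at \<open>0\<close> up to a factor.
\<close>

section \<open>Finite fields\<close>

text \<open>Multiplication by \<open>x\<close> permutes the nonzero elements, so their product
  absorbs a factor \<open>x\<close> for each of them and stays the same.\<close>

lemma finite_field_power_card:
  fixes x :: "'a::{field,finite}"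
  assumes "x \<noteq> 0"
  shows "x ^ (card (UNIV :: 'a set) - 1) = 1"
proof -
  have "(\<Prod>y\<in>UNIV-{0}. x * y) = (\<Prod>y\<in>UNIV-{0}. y)"
    by (rule prod.reindex_bij_witness[of _ "\<lambda>y. y / x" "\<lambda>y. x * y"]) (use assms in auto)
  hence "x ^ (card (UNIV :: 'a set) - 1) * \<Prod>(UNIV-{0}) = \<Prod>(UNIV-{0::'a})"
    by (simp add: prod.distrib)
  thus ?thesis by simp
qed

lemma finite_field_card_roots_power_eq_one:
  fixes n :: nat
  assumes "n > 0"
  shows "card {x :: 'a::{field,finite}. x ^ n = 1} \<le> n"
proof -
  let ?p = "Polynomial.monom (1::'a) n - 1"
  have "Polynomial.coeff ?p n = 1" using assms by simp
  hence "?p \<noteq> 0" by (metis coeff_0 zero_neq_one)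
  moreover have "Polynomial.degree ?p \<le> n"
    by (rule degree_diff_le) (simp_all add: degree_monom_le)
  ultimately have "card {x. poly ?p x = 0} \<le> n"
    using card_poly_roots_bound[of ?p] by linarith
  thus ?thesis by (simp add: poly_monom)
qed

text \<open>Squaring is at most two-to-one on nonzero elements, so at least \<open>n\<close> of them
  are squares. All of these are roots of \<open>z ^ n = 1\<close>, which has at most
  \<open>n\<close> roots, so the two sets coincide.\<close>

lemma finite_field_euler_criterion:
  fixes x :: "'a::{field,finite}"
  assumes odd: "odd (card (UNIV :: 'a set))"
    and x: "x ^ ((card (UNIV :: 'a set) - 1) div 2) = 1"
  shows "\<exists>y. y ^ 2 = x"
proof -
  define n where "n = (card (UNIV :: 'a set) - 1) div 2"
  let ?S = "(\<lambda>y. y ^ 2) ` (UNIV - {0::'a})"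
  have card_eq: "card (UNIV - {0::'a}) = 2 * n"
    using odd by (simp add: n_def card_Diff_subset)
  have n: "n > 0"
  proof (rule ccontr)
    assume "\<not> n > 0"
    hence "card (UNIV - {0::'a}) = 0" using card_eq by simp
    hence "UNIV - {0::'a} = {}" by (simp only: card_0_eq finite)
    thus False by (metis DiffI UNIV_I empty_iff singletonD zero_neq_one)
  qed
  have "UNIV - {0::'a} = (\<Union>z\<in>?S. {y \<in> UNIV - {0}. y ^ 2 = z})" by auto
  hence "card (UNIV - {0::'a}) = card (\<Union>z\<in>?S. {y \<in> UNIV - {0}. y ^ 2 = z})" by (rule arg_cong)
  also have "\<dots> \<le> (\<Sum>z\<in>?S. card {y \<in> UNIV - {0}. y ^ 2 = z})" by (rule card_UN_le) simp
  also have "\<dots> \<le> (\<Sum>z\<in>?S. 2)"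
  proof (rule sum_mono)
    fix z assume "z \<in> ?S"
    then obtain w where "z = w ^ 2" by auto
    hence "{y \<in> UNIV - {0}. y ^ 2 = z} \<subseteq> {w, - w}" by (auto simp: power2_eq_iff)
    hence "card {y \<in> UNIV - {0}. y ^ 2 = z} \<le> card {w, - w}" by (rule card_mono[rotated]) simp
    also have "\<dots> \<le> 2" by (simp add: card_insert_if)
    finally show "card {y \<in> UNIV - {0}. y ^ 2 = z} \<le> 2" .
  qed
  finally have "n \<le> card ?S" using card_eq by simp
  moreover have "?S \<subseteq> {z. z ^ n = 1}"
  proof clarsimp
    fix y :: 'a assume "y \<noteq> 0"
    hence "y ^ (2 * n) = 1" using finite_field_power_card[of y] odd by (simp add: n_def)
    thus "(y ^ 2) ^ n = 1" by (simp add: power_mult)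
  qed
  ultimately have roots: "?S = {z. z ^ n = 1}"
    using finite_field_card_roots_power_eq_one[OF n, where 'a='a]
    by (intro card_seteq) auto
  have "x \<in> {z. z ^ n = 1}" using x by (simp add: n_def)
  hence "x \<in> ?S" by (simp only: roots)
  thus ?thesis by auto
qed

text \<open>Any square root \<open>y\<close> satisfies \<open>y^(r - 1) = x^((r - 1)/2) = 1\<close>, so it lies in the subfield by itself.\<close>

lemma subfield_square_root:
  fixes x :: "'a::{field,finite}"
  assumes card: "card (UNIV :: 'a set) = r ^ n" and r: "odd r" "r > 1"
    and x: "x ^ ((r - 1) div 2) = 1"
  shows "\<exists>y. y ^ 2 = x \<and> y ^ r = y"
proof -
  \<comment> \<open>That \<open>r - 1\<close> divides \<open>r ^ n - 1\<close> lifts the condition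
    on \<open>x\<close> from the subfield to the whole field.\<close>
  have "\<exists>m. r ^ n = (r - 1) * m + 1"
  proof (induction n)
    case (Suc n)
    then obtain m where m: "r ^ n = (r - 1) * m + 1" by blast
    have "r ^ Suc n = (r - 1) * (r * m) + r" using m by (simp add: distrib_left mult.left_commute)
    also have "\<dots> = (r - 1) * (r * m + 1) + 1" using r by simp
    finally show ?case by blast
  qed auto
  then obtain m where m: "r ^ n - 1 = (r - 1) * m" by fastforce
  have "2 dvd r - 1" using r by simp
  then obtain h where h: "r - 1 = 2 * h" by (rule dvdE)
  have "(r - 1) div 2 = h" unfolding h by simp
  hence xh: "x ^ h = 1" using x by simp
  have "(r ^ n - 1) div 2 = h * m" unfolding m h by simp
  hence "x ^ ((card (UNIV :: 'a set) - 1) div 2) = 1" by (simp only: card power_mult xh power_one)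
  moreover have "odd (card (UNIV :: 'a set))" using r by (simp add: card)
  ultimately obtain y where y: "y ^ 2 = x"
    using finite_field_euler_criterion by blast
  have "y ^ (r - 1) = 1" unfolding h by (simp only: power_mult y xh)
  hence "y ^ Suc (r - 1) = y" by simp
  moreover have "Suc (r - 1) = r" using r by simp
  ultimately show ?thesis using y by metis
qed

text \<open>This is what makes the powers \<open>q ^ n\<close> additive exponents and excludes
  characteristic 2 for odd \<open>q\<close>.\<close>

lemma finite_field_primepow_CHAR:
  assumes "card (UNIV :: 'a::{field,finite} set) = q ^ n" and "primepow q"
  shows "prime CHAR('a) \<and> (\<exists>m. q = CHAR('a) ^ m)"
proof -
  have p: "prime CHAR('a)"
    by (rule prime_CHAR_semidom) (simp add: finite_imp_CHAR_pos)
  obtain r m where r: "prime r" "q = r ^ m" using assms(2) by (auto simp: primepow_def)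
  have "CHAR('a) dvd (r ^ m) ^ n" using CHAR_dvd_CARD[where 'a='a] assms(1) r by simp
  hence "CHAR('a) = r" using p r(1) prime_dvd_power primes_dvd_imp_eq by metis
  thus ?thesis using p r by blast
qed

section \<open>Additive maps and linearity over the prime field\<close>

lemma additive_imp_prime_field_linear:
  assumes add: "\<And>x y. f (x + y) = f x + f y"
  shows "prime_field_linear f"
proof -
  have "f 0 + f 0 = f 0 + 0" using add[of 0 0] by simp
  hence zero: "f 0 = 0" by (rule add_left_imp_eq)
  have minus: "f (- x) = - f x" for x
    using add[of x "- x"] zero by (simp add: eq_neg_iff_add_eq_0 add.commute)
  have nat: "f (of_nat n * x) = of_nat n * f x" for n x
    by (induction n) (simp_all add: zero add algebra_simps)
  have "f (of_int c * x) = of_int c * f x" for c x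
    by (cases c) (simp_all only: of_int_of_nat_eq of_int_minus mult_minus_left minus nat)
  thus ?thesis using add by (simp add: prime_field_linear_def)
qed

lemma prime_field_linear_inv:
  assumes "prime_field_linear f" and "bij f"
  shows "prime_field_linear (inv_into UNIV f)"
proof (rule additive_imp_prime_field_linear)
  fix x y
  have "f (inv_into UNIV f x + inv_into UNIV f y) = x + y"
    using assms by (simp add: prime_field_linear_def bij_is_surj surj_f_inv_f)
  thus "inv_into UNIV f (x + y) = inv_into UNIV f x + inv_into UNIV f y"
    using assms(2) by (metis bij_is_inj inv_f_f)
qed

lemma additive_bij:
  fixes f :: "'a::{field,finite} \<Rightarrow> 'a"
  assumes add: "\<And>x y. f (x + y) = f x + f y" and ker: "\<And>x. f x = 0 \<Longrightarrow> x = 0"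
  shows "bij f"
proof -
  have "inj f"
  proof (rule injI)
    fix x y assume "f x = f y"
    hence "f (x - y) = 0" using add[of "x - y" y] by simp
    thus "x = y" using ker[of "x - y"] by simp
  qed
  thus ?thesis by (simp add: bij_def finite_UNIV_inj_surj)
qed

section \<open>The conjugation of a field of order \<open>q\<^sup>2\<^sup>l\<close>\<close>

locale conjugate_field =
  fixes q l :: nat and bar tau :: "'a::{field,finite} \<Rightarrow> 'a"
  assumes primepow: "primepow q" and odd_q: "odd q" and odd_l: "odd l"
    and card_field: "card (UNIV :: 'a set) = q ^ (2 * l)"
    and bar_def: "bar = (\<lambda>x. x ^ (q ^ l))"
    and tau_def: "tau = (\<lambda>x. x ^ (q ^ 2))"
begin

abbreviation twist :: "'a \<Rightarrow> 'a \<Rightarrow> 'a" where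
  "twist x y \<equiv> x * tau y + tau x * y"

lemma two_neq_zero: "(2::'a) \<noteq> 0"
proof
  assume "(2::'a) = 0"
  hence "of_nat 2 = (0::'a)" by simp
  hence "CHAR('a) dvd 2" by (simp only: of_nat_eq_0_iff_char_dvd)
  moreover obtain m where p: "prime CHAR('a)" and m: "q = CHAR('a) ^ m"
    using finite_field_primepow_CHAR[OF card_field primepow] by blast
  ultimately have "CHAR('a) = 2" by (meson primes_dvd_imp_eq two_is_prime_nat)
  moreover have "m > 0" using m primepow by (cases m) auto
  ultimately show False using m odd_q by simp
qed

lemma eq_minus_self_iff: "(x::'a) = - x \<longleftrightarrow> x = 0"
proof
  assume "x = - x"
  hence "x + x = 0" by (metis add.right_inverse)
  hence "2 * x = 0" by (simp only: mult_2)
  thus "x = 0" using two_neq_zero by simp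
qed simp

lemma frob_add: "(x + y :: 'a) ^ (q ^ n) = x ^ (q ^ n) + y ^ (q ^ n)"
proof -
  obtain m where p: "prime CHAR('a)" and m: "q = CHAR('a) ^ m"
    using finite_field_primepow_CHAR[OF card_field primepow] by blast
  show ?thesis
    by (rule freshmans_dream'[OF p, of _ "m * n"]) (simp add: m power_mult)
qed

lemma frob_minus: "(- x :: 'a) ^ (q ^ n) = - (x ^ (q ^ n))"
  using odd_q by (simp add: power_minus_odd)

lemma frob_diff: "(x - y :: 'a) ^ (q ^ n) = x ^ (q ^ n) - y ^ (q ^ n)"
  using frob_add[of x "- y" n] by (simp add: frob_minus)

lemma frob_sum: "(sum f A :: 'a) ^ (q ^ n) = (\<Sum>i\<in>A. f i ^ (q ^ n))"
  by (induction A rule: infinite_finite_induct) (simp_all add: frob_add zero_power odd_pos odd_q)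

lemma frob_frob: "((x :: 'a) ^ (q ^ m)) ^ (q ^ n) = x ^ (q ^ (m + n))"
  by (simp add: power_mult power_add)

lemma frob_full: "(x :: 'a) ^ (q ^ (2 * l)) = x"
proof (cases "x = 0")
  case False
  have "x ^ Suc (card (UNIV :: 'a set) - 1) = x"
    using finite_field_power_card[OF False] by simp
  thus ?thesis using odd_q by (simp add: card_field odd_pos del: power_Suc)
qed (simp add: odd_pos odd_q zero_power)

lemma bar_add: "bar (x + y) = bar x + bar y"
  and bar_diff: "bar (x - y) = bar x - bar y"
  and bar_minus: "bar (- x) = - bar x"
  and bar_mult: "bar (x * y) = bar x * bar y"
  and bar_divide: "bar (x / y) = bar x / bar y"
  and bar_tau: "bar (tau x) = tau (bar x)"
  by (simp_all add: bar_def tau_def frob_add frob_diff frob_minus frob_frob power_mult_distrib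
      power_divide add.commute)

lemma bar_bar: "bar (bar x) = x"
  using frob_full[of x] by (simp add: bar_def frob_frob mult_2)

lemma bar_0: "bar 0 = 0" and bar_1: "bar 1 = 1"
  by (simp_all add: bar_def zero_power odd_pos odd_q)

lemma bar_numeral: "bar (numeral n) = numeral n"
proof -
  have "bar (of_nat m) = of_nat m" for m
    by (induction m) (simp_all add: bar_0 bar_1 bar_add)
  from this[of "numeral n"] show ?thesis by simp
qed

lemma bar_eq_0_iff: "bar x = 0 \<longleftrightarrow> x = 0"
  by (simp add: bar_def odd_pos odd_q)

lemma tau_add: "tau (x + y) = tau x + tau y"
  and tau_minus: "tau (- x) = - tau x"
  and tau_mult: "tau (x * y) = tau x * tau y"
  and tau_divide: "tau (x / y) = tau x / tau y"
  by (simp_all add: tau_def frob_add frob_minus power_mult_distrib power_divide)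

lemma tau_0: "tau 0 = 0"
  by (simp add: tau_def zero_power odd_pos odd_q)

lemma tau_eq_0_iff: "tau x = 0 \<longleftrightarrow> x = 0"
  by (simp add: tau_def odd_pos odd_q)

text \<open>Since \<open>l\<close> is odd, applying \<open>tau\<close> \<open>l\<close> times gives \<open>x = - x\<close>.\<close>

lemma tau_eq_minus:
  assumes "tau x = - x"
  shows "x = 0"
proof -
  have "x ^ (q ^ (2 * n)) = (- 1) ^ n * x" for n
  proof (induction n)
    case (Suc n)
    have "x ^ (q ^ (2 * Suc n)) = tau (x ^ (q ^ (2 * n)))"
      by (simp add: tau_def frob_frob)
    thus ?case using Suc assms by (cases "even n") (simp_all add: tau_minus)
  qed simp
  from this[of l] have "x = - x" using frob_full[of x] odd_l by simp
  thus ?thesis by (simp only: eq_minus_self_iff)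
qed

text \<open>
  Writing \<open>u = x * y\<close>, so that \<open>bar u = - u\<close>, the second hypothesis multiplied by the norm of
  \<open>x * tau x\<close> factors as
  \<open>(x * tau (bar x) + bar x * tau x) * (tau u * x * bar x + u * tau (x * bar x)) = 0\<close>.
  A vanishing factor says that \<open>bar x / x\<close> or \<open>y / bar x\<close> is negated by \<open>tau\<close>.
\<close>

lemma trace_twist_nonsingular:
  assumes tr: "x * y + bar (x * y) = 0" and tw: "bar (twist x y) = twist x y"
  shows "x = 0 \<or> y = 0"
proof (rule ccontr)
  assume "\<not> (x = 0 \<or> y = 0)"
  hence x: "x \<noteq> 0" and y: "y \<noteq> 0" by auto
  have x': "bar x \<noteq> 0" "tau x \<noteq> 0" "tau (bar x) \<noteq> 0"
    using x by (simp_all add: bar_eq_0_iff tau_eq_0_iff)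
  have u: "bar x * bar y = - (x * y)"
    using tr by (simp add: bar_mult eq_neg_iff_add_eq_0 add.commute)
  hence tu: "tau (bar x) * tau (bar y) = - (tau x * tau y)"
    by (metis tau_mult tau_minus)
  have tw': "bar x * tau (bar y) + tau (bar x) * bar y = x * tau y + tau x * y"
    using tw by (simp add: bar_add bar_mult bar_tau)
  have "(x * tau (bar x) + bar x * tau x) *
      (tau x * tau y * (x * bar x) + x * y * (tau x * tau (bar x))) =
      (x * tau y + tau x * y) * (x * tau x * (bar x * tau (bar x)))
       + (tau x * tau y * (bar x)\<^sup>2 + x * y * (tau (bar x))\<^sup>2) * (x * tau x)"
    by (simp add: algebra_simps power2_eq_square)
  \<comment> \<open>By \<open>u\<close> and \<open>tu\<close> the extra terms become minus the
    conjugated twist times the same cofactor, so \<open>tw'\<close> cancels everything.\<close>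
  also have "(tau x * tau y * (bar x)\<^sup>2 + x * y * (tau (bar x))\<^sup>2) * (x * tau x) =
      - ((tau (bar x) * tau (bar y) * (bar x)\<^sup>2 + bar x * bar y * (tau (bar x))\<^sup>2) * (x * tau x))"
    unfolding u tu by (simp add: algebra_simps)
  also have "\<dots> = - ((bar x * tau (bar y) + tau (bar x) * bar y)
      * (x * tau x * (bar x * tau (bar x))))"
    by (simp add: algebra_simps power2_eq_square)
  finally have "(x * tau (bar x) + bar x * tau x) *
      (tau x * tau y * (x * bar x) + x * y * (tau x * tau (bar x))) = 0"
    unfolding tw' by simp
  then consider "x * tau (bar x) + bar x * tau x = 0"
    | "tau x * tau y * (x * bar x) + x * y * (tau x * tau (bar x)) = 0"
    by auto
  thus False
  proof cases
    case 1
    hence "tau (bar x / x) = - (bar x / x)"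
      using x x' by (simp add: tau_divide field_simps eq_neg_iff_add_eq_0)
    thus False using tau_eq_minus[of "bar x / x"] x x' by simp
  next
    case 2
    hence "(x * tau x) * (tau y * bar x + y * tau (bar x)) = 0" by (simp add: algebra_simps)
    hence "tau y * bar x + y * tau (bar x) = 0" using x x' by simp
    hence "tau (y / bar x) = - (y / bar x)"
      using x' by (simp add: tau_divide field_simps eq_neg_iff_add_eq_0)
    thus False using tau_eq_minus[of "y / bar x"] x' y by simp
  qed
qed

text \<open>Applying \<open>bar\<close> to the sum gives \<open>a - b = 0\<close>, and 2 is
  invertible. This separates both products into a trace condition and a twist condition.\<close>

lemma bar_parts_eq_0:
  assumes "bar a = a" and "bar b = - b" and "a + b = 0"
  shows "a = 0 \<and> b = 0"
proof -
  have "a - b = 0" using assms by (metis add_uminus_conv_diff bar_0 bar_add)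
  hence "b = - b" using assms(3) by (simp add: eq_neg_iff_add_eq_0)
  hence "b = 0" by (simp only: eq_minus_self_iff)
  thus ?thesis using assms(3) by simp
qed

section \<open>The two multiplications in terms of conjugation\<close>

lemma P_mult_eq:
  "P_mult s q l x y = 1 / 2 * (x * y + bar (x * y)) + 1 / 4 * P_fun s q l (twist x y)"
  by (simp add: P_mult_def bar_def tau_def power_mult_distrib)

lemma B_mult_eq:
  "B_mult q l 2 \<omega> \<beta> x y = x * bar y + bar x * y + (\<beta> * twist x y + bar (\<beta> * twist x y)) * \<omega>"
  by (simp add: B_mult_def bar_def tau_def power_mult_distrib)

lemma P_fun_add: "P_fun s q l (x + y :: 'a) = P_fun s q l x + P_fun s q l y"
proof -
  have diff: "x + y - (x + y) ^ (q ^ l) = (x - x ^ (q ^ l)) + (y - y ^ (q ^ l))"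
    by (simp add: frob_add)
  show ?thesis
    unfolding P_fun_def Let_def diff by (simp only: frob_add distrib_left sum.distrib add_ac)
qed

lemma P_fun_minus: "P_fun s q l (- x :: 'a) = - P_fun s q l x"
proof -
  have "P_fun s q l (0 :: 'a) = 0"
    by (simp add: P_fun_def zero_power odd_pos odd_q)
  thus ?thesis using P_fun_add[of s x "- x"] by (simp add: eq_neg_iff_add_eq_0 add.commute)
qed

text \<open>\<open>bar\<close> commutes with all Frobenius powers and reverses the sign of
  \<open>x - bar x\<close>, the only quantity through which \<open>P_fun\<close> sees
  \<open>x\<close>.\<close>

lemma bar_P_fun: "bar (P_fun s q l x) = - P_fun s q l x"
proof -
  have sgn: "((- 1) ^ i :: 'a) ^ (q ^ l) = (- 1) ^ i" for i
    using odd_q by (cases "even i") auto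
  have "bar (P_fun s q l x) = P_fun s q l (bar x)"
    by (simp add: P_fun_def Let_def bar_def frob_add frob_sum frob_diff frob_frob
        power_mult_distrib sgn add.commute del: power_Suc)
  also have "\<dots> = P_fun s q l (- x)"
    using bar_bar[of x] by (simp add: P_fun_def bar_def frob_minus)
  finally show ?thesis by (simp add: P_fun_minus)
qed

text \<open>Up to sign, \<open>tau\<close> shifts each sum by one index, so adding it makes both
  sums telescope. Of the four boundary terms, two cancel and two equal
  \<open>x - bar x\<close>.\<close>

lemma P_fun_tau:
  assumes "l > 1"
  shows "P_fun 0 q l x + tau (P_fun 0 q l x) = 2 * (x - bar x)"
proof -
  define k where "k = (l - 1) div 2"
  have l: "l = 2 * k + 1" and k: "k \<ge> 1" using odd_l assms by (auto simp: k_def elim!: oddE)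
  define u where "u = x - x ^ (q ^ l)"
  define f where "f i = (- 1) ^ i * u ^ (q ^ (2 * i))" for i
  define g where "g j = (- 1) ^ (k + j) * u ^ (q ^ (2 * j + 1))" for j
  have sgn: "((- 1) ^ i :: 'a) ^ (q ^ n) = (- 1) ^ i" for i n
    using odd_q by (cases "even i") auto
  have tau_f: "tau (f i) = - f (Suc i)" for i
    by (simp add: tau_def f_def power_mult_distrib sgn frob_frob)
  have tau_g: "tau (g i) = - g (Suc i)" for i
  proof -
    have "(u ^ (q ^ (2 * i + 1))) ^ (q ^ 2) = u ^ (q ^ (2 * Suc i + 1))"
      by (simp only: frob_frob) simp
    thus ?thesis by (simp only: tau_def g_def power_mult_distrib sgn) simp
  qed
  have tau_sum: "tau (sum h A) = (\<Sum>i\<in>A. tau (h i))" for h :: "nat \<Rightarrow> 'a" and A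
    by (simp add: tau_def frob_sum)
  have sum: "P_fun 0 q l x = sum f {..<Suc k} + sum g {..<k}"
  proof -
    \<comment> \<open>The first equation relies on \<open>k \<ge> 1\<close>: for
      \<open>k = 0\<close> truncated subtraction would leave the index 0 in the range.\<close>
    have "{0..k - 1} = {..<k}" "{0..k} = {..<Suc k}" using k by auto
    thus ?thesis by (simp only: P_fun_def Let_def f_def[abs_def] g_def[abs_def] u_def flip: k_def)
  qed
  have "P_fun 0 q l x + tau (P_fun 0 q l x) =
      (\<Sum>i<Suc k. f i - f (Suc i)) + (\<Sum>i<k. g i - g (Suc i))"
    unfolding sum tau_add tau_sum tau_f tau_g sum_subtractf sum_negf
    by (simp only: diff_conv_add_uminus add_ac)
  also have "\<dots> = f 0 - f (Suc k) + (g 0 - g k)"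
    by (simp only: sum_lessThan_telescope')
  finally have sum_tau: "P_fun 0 q l x + tau (P_fun 0 q l x) = f 0 - f (Suc k) + (g 0 - g k)" .
  have ul: "u ^ (q ^ l) = - u"
    using bar_bar[of x] by (simp add: u_def frob_diff bar_def)
  have f0: "f 0 = u" by (simp add: f_def)
  have "(- 1) ^ (k + k) = (1 :: 'a)" by simp
  hence gk: "g k = - u" by (simp only: g_def l[symmetric] ul mult_1)
  \<comment> \<open>Since \<open>2 * Suc k = l + 1\<close>, the last term of the even sum is the
    first term of the odd sum.\<close>
  have "u ^ (q ^ (2 * Suc k)) = (u ^ (q ^ l)) ^ (q ^ 1)"
    unfolding frob_frob by (simp add: l)
  also have "\<dots> = - (u ^ (q ^ 1))" by (simp only: ul frob_minus)
  finally have "f (Suc k) = g 0" by (simp add: f_def g_def)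
  thus ?thesis unfolding sum_tau f0 gk by (simp add: u_def bar_def)
qed

lemma P_mult_add:
  "P_mult s q l x (y + z :: 'a) = P_mult s q l x y + P_mult s q l x z"
  "P_mult s q l (x + y) z = P_mult s q l x z + P_mult s q l y z"
proof -
  have "twist x (y + z) = twist x y + twist x z" "twist (x + y) z = twist x z + twist y z"
    by (simp_all add: tau_add algebra_simps)
  thus "P_mult s q l x (y + z) = P_mult s q l x y + P_mult s q l x z"
    "P_mult s q l (x + y) z = P_mult s q l x z + P_mult s q l y z"
    by (simp_all only: P_mult_eq P_fun_add) (simp_all add: bar_add bar_mult algebra_simps)
qed

lemma P_mult_commute: "P_mult s q l x (y :: 'a) = P_mult s q l y x"
  by (simp add: P_mult_eq mult.commute add.commute)

lemma B_mult_add: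
  "B_mult q l 2 \<omega> \<beta> x (y + z :: 'a) = B_mult q l 2 \<omega> \<beta> x y + B_mult q l 2 \<omega> \<beta> x z"
  "B_mult q l 2 \<omega> \<beta> (x + y) z = B_mult q l 2 \<omega> \<beta> x z + B_mult q l 2 \<omega> \<beta> y z"
  by (simp_all add: B_mult_eq tau_add bar_add bar_mult algebra_simps)

lemma B_mult_commute: "B_mult q l 2 \<omega> \<beta> x (y :: 'a) = B_mult q l 2 \<omega> \<beta> y x"
  by (simp add: B_mult_eq mult.commute add.commute)

lemma four_neq_zero: "(4::'a) \<noteq> 0"
  using two_neq_zero by (metis mult_2 mult_eq_0_iff numeral_Bit0)

text \<open>The trace summand is fixed by \<open>bar\<close> and the \<open>P_fun\<close> summand is
  negated, so both vanish with the product; \<open>P_fun_tau\<close> then recovers the twist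
  condition.\<close>

lemma presemifield_P_mult:
  assumes "l > 1"
  shows "commutative_presemifield (P_mult 0 q l :: 'a \<Rightarrow> 'a \<Rightarrow> 'a)"
proof -
  have "x = 0 \<or> y = 0" if "P_mult 0 q l x y = 0" for x y :: 'a
  proof -
    have "1 / 2 * (x * y + bar (x * y)) = 0 \<and> 1 / 4 * P_fun 0 q l (twist x y) = 0"
    proof (rule bar_parts_eq_0)
      show "bar (1 / 2 * (x * y + bar (x * y))) = 1 / 2 * (x * y + bar (x * y))"
        by (simp add: bar_divide bar_mult bar_add bar_bar bar_numeral bar_1 add.commute)
      show "bar (1 / 4 * P_fun 0 q l (twist x y)) = - (1 / 4 * P_fun 0 q l (twist x y))"
        by (simp only: bar_mult bar_divide bar_numeral bar_1 bar_P_fun mult_minus_right)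
    qed (use that in \<open>simp only: P_mult_eq\<close>)
    hence tr: "x * y + bar (x * y) = 0" and "P_fun 0 q l (twist x y) = 0"
      using two_neq_zero four_neq_zero by simp_all
    hence "2 * (twist x y - bar (twist x y)) = 0"
      using P_fun_tau[OF assms, of "twist x y"] by (simp only: tau_0 add_0_left)
    hence "bar (twist x y) = twist x y" using two_neq_zero by (metis mult_eq_0_iff eq_iff_diff_eq_0)
    with tr show ?thesis by (rule trace_twist_nonsingular)
  qed
  thus ?thesis
    unfolding commutative_presemifield_def presemifield_def
    using P_mult_add P_mult_commute by blast
qed

end

section \<open>The isotopism\<close>

locale isotopism = conjugate_field +
  fixes \<omega> \<beta> i c :: 'a
  assumes bar_omega: "bar \<omega> = - \<omega>" and omega: "\<omega> \<noteq> 0"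
    and i_sq: "i * i = - 1" and bar_i: "bar i = i" and tau_i: "tau i = i"
    and tau_c: "tau c = c" and beta_c: "\<beta> * (c * c) * \<omega> = 1"
begin

definition M :: "'a \<Rightarrow> 'a" where
  "M x = c * (x + i * bar x)"

lemma c_neq_zero: "c \<noteq> 0" and i_neq_zero: "i \<noteq> 0"
  using beta_c i_sq by auto

lemma i_sq_left: "i * (i * x) = - x"
  by (simp flip: mult.assoc add: i_sq)

lemma M_add: "M (x + y) = M x + M y"
  by (simp add: M_def bar_add algebra_simps)

text \<open>On the kernel \<open>x = - i * bar x\<close>; conjugating and substituting back gives
  \<open>x = i * i * x = - x\<close>.\<close>

lemma bij_M: "bij M"
proof (rule additive_bij[OF M_add])
  fix x assume "M x = 0"
  hence x: "x = - (i * bar x)" using c_neq_zero by (simp add: M_def eq_neg_iff_add_eq_0)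
  hence "bar x = - (i * x)" by (metis bar_bar bar_i bar_minus bar_mult)
  with x have "x = - x" by (simp add: i_sq_left)
  thus "x = 0" by (simp only: eq_minus_self_iff)
qed

lemma twist_M:
  "twist (M x) (M y) = c * c * (twist x y - bar (twist x y) +
     i * (x * tau (bar y) + bar x * tau y + tau x * bar y + tau (bar x) * y))"
  by (simp add: M_def tau_mult tau_add tau_c tau_i bar_add bar_mult bar_tau i_sq_left algebra_simps)

text \<open>The factor \<open>c * c\<close> cancels \<open>\<beta>\<close> up to
  \<open>1 / \<omega>\<close>. As \<open>\<omega>\<close> is negated by \<open>bar\<close>,
  \<open>D / \<omega>\<close> is fixed and \<open>i * R / \<omega>\<close> is negated, so the trace
  keeps only \<open>D\<close>.\<close>

lemma B_mult_M:
  "B_mult q l 2 \<omega> \<beta> (M x) (M y) =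
     2 * i * c * bar c * (x * y + bar (x * y)) + 2 * (twist x y - bar (twist x y))"
proof -
  define D where "D = twist x y - bar (twist x y)"
  define R where "R = x * tau (bar y) + bar x * tau y + tau x * bar y + tau (bar x) * y"
  have D: "bar D = - D" by (simp add: D_def bar_diff bar_bar)
  have R: "bar R = R" by (simp add: R_def bar_add bar_mult bar_tau bar_bar algebra_simps)
  have beta: "\<beta> * (c * c) = 1 / \<omega>" using beta_c omega by (simp add: field_simps)
  have twist: "\<beta> * twist (M x) (M y) = (D + i * R) / \<omega>"
    unfolding twist_M D_def[symmetric] R_def[symmetric]
    by (simp only: mult.assoc[symmetric] beta[unfolded mult.assoc[symmetric]]) simp
  have "(\<beta> * twist (M x) (M y) + bar (\<beta> * twist (M x) (M y))) * \<omega> = 2 * D"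
    unfolding twist using omega by (simp add: bar_divide bar_add bar_mult D R bar_i bar_omega field_simps)
  moreover have "M x * bar (M y) + bar (M x) * M y = 2 * i * c * bar c * (x * y + bar (x * y))"
    by (simp add: M_def bar_add bar_mult bar_bar bar_i i_sq_left algebra_simps)
  ultimately show ?thesis by (simp add: B_mult_eq D_def)
qed

text \<open>As \<open>M\<close> is onto, it suffices to treat arguments \<open>M x'\<close> and
  \<open>M y'\<close>, where \<open>B_mult_M\<close> separates the two conditions.\<close>

lemma presemifield_B_mult: "commutative_presemifield (B_mult q l 2 \<omega> \<beta>)"
proof -
  have "x = 0 \<or> y = 0" if "B_mult q l 2 \<omega> \<beta> x y = 0" for x y
  proof -
    obtain x' y' where M: "x = M x'" "y = M y'" using bij_M by (metis bij_pointE)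
    have "2 * i * c * bar c * (x' * y' + bar (x' * y')) = 0 \<and>
        2 * (twist x' y' - bar (twist x' y')) = 0"
    proof (rule bar_parts_eq_0)
      show "2 * i * c * bar c * (x' * y' + bar (x' * y')) +
          2 * (twist x' y' - bar (twist x' y')) = 0"
        using that by (simp only: M B_mult_M)
    qed (simp_all add: bar_mult bar_add bar_diff bar_bar bar_numeral bar_i algebra_simps)
    hence "x' * y' + bar (x' * y') = 0" and "twist x' y' - bar (twist x' y') = 0"
      using two_neq_zero i_neq_zero c_neq_zero by (simp_all only: mult_eq_0_iff bar_eq_0_iff) simp_all
    hence "x' * y' + bar (x' * y') = 0" "bar (twist x' y') = twist x' y'"
      by (simp_all only: right_minus_eq)
    hence "x' = 0 \<or> y' = 0" by (rule trace_twist_nonsingular)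
    thus ?thesis by (auto simp: M M_def bar_0)
  qed
  thus ?thesis
    unfolding commutative_presemifield_def presemifield_def
    using B_mult_add B_mult_commute by blast
qed

text \<open>The inverse of the second isotopism map. The first term extracts half the trace of
  \<open>x * y\<close>, the second a quarter of \<open>P_fun\<close> of the twist.\<close>

definition K :: "nat \<Rightarrow> 'a \<Rightarrow> 'a" where
  "K s z = (z + bar z) / (8 * i * c * bar c) + P_fun s q l z / 16"

lemma K_add: "K s (x + y) = K s x + K s y"
  by (simp add: K_def P_fun_add bar_add add_divide_distrib)

lemma K_B_mult: "K s (B_mult q l 2 \<omega> \<beta> (M x) (M y)) = P_mult s q l x y"
proof -
  define t where "t = x * y + bar (x * y)"
  define A where "A = twist x y"
  define z where "z = 2 * i * c * bar c * t + 2 * (A - bar A)"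
  have t: "bar t = t" by (simp add: t_def bar_add bar_bar add.commute)
  have bar_z: "bar z = 2 * i * c * bar c * t - 2 * (A - bar A)"
    by (simp add: z_def bar_add bar_diff bar_mult bar_bar bar_numeral bar_i t algebra_simps)
  \<comment> \<open>\<open>P_fun\<close> depends only on the difference of its argument and its
    conjugate, so \<open>z\<close> may be replaced by \<open>4 * A\<close>.\<close>
  have "z - bar z = 4 * A - bar (4 * A)"
    by (simp add: bar_z bar_mult bar_numeral) (simp add: z_def algebra_simps)
  hence "P_fun s q l z = P_fun s q l (4 * A)" by (simp add: P_fun_def bar_def)
  also have "4 * A = (A + A) + (A + A)" by simp
  finally have P_z: "P_fun s q l z = 4 * P_fun s q l A" unfolding P_fun_add by simp
  have tr_z: "z + bar z = 4 * (i * c * bar c * t)" by (simp add: bar_z) (simp add: z_def)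
  have "(8::'a) = 4 * 2" "(16::'a) = 4 * 4" by simp_all
  hence nz: "(8::'a) \<noteq> 0" "(16::'a) \<noteq> 0"
    using two_neq_zero four_neq_zero by (simp_all only: mult_eq_0_iff) simp_all
  have "(z + bar z) / (8 * i * c * bar c) = t / 2"
    unfolding tr_z using nz two_neq_zero i_neq_zero c_neq_zero
    by (simp add: bar_eq_0_iff field_simps)
  moreover have "P_fun s q l z / 16 = P_fun s q l A / 4"
    unfolding P_z using nz four_neq_zero by (simp add: field_simps)
  ultimately have "K s z = t / 2 + P_fun s q l A / 4" by (simp only: K_def)
  moreover have "B_mult q l 2 \<omega> \<beta> (M x) (M y) = z"
    by (simp only: B_mult_M z_def t_def A_def)
  moreover have "P_mult s q l x y = t / 2 + P_fun s q l A / 4"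
    by (simp add: P_mult_eq t_def A_def)
  ultimately show ?thesis by simp
qed

text \<open>
  If \<open>K s z = 0\<close> with \<open>z \<noteq> 0\<close>, then the solution \<open>y\<close> of \<open>M 1 \<star> M y = z\<close> would satisfy
  \<open>1 * y = K s z = 0\<close>.
\<close>

lemma bij_K:
  assumes "presemifield (P_mult s q l :: 'a \<Rightarrow> 'a \<Rightarrow> 'a)"
  shows "bij (K s)"
proof (rule additive_bij[OF K_add])
  fix z assume z: "K s z = 0"
  have M1: "M 1 \<noteq> 0" using bij_M by (metis M_add add_cancel_right_right bij_pointE zero_neq_one)
  have "bij (B_mult q l 2 \<omega> \<beta> (M 1))"
    using presemifield_B_mult M1
    by (intro additive_bij B_mult_add(1)) (auto simp: commutative_presemifield_def presemifield_def)
  then obtain y' where "z = B_mult q l 2 \<omega> \<beta> (M 1) y'" by (metis bij_pointE)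
  moreover obtain y where "y' = M y" using bij_M by (metis bij_pointE)
  ultimately have y: "z = B_mult q l 2 \<omega> \<beta> (M 1) (M y)" by simp
  hence "P_mult s q l 1 y = 0" using z by (simp add: K_B_mult)
  hence "y = 0" using assms unfolding presemifield_def by (metis zero_neq_one)
  thus "z = 0" using y by (simp add: B_mult_M tau_0 bar_0)
qed

lemma strongly_isotopic_P_B:
  assumes "presemifield (P_mult s q l :: 'a \<Rightarrow> 'a \<Rightarrow> 'a)"
  shows "strongly_isotopic (P_mult s q l) (B_mult q l 2 \<omega> \<beta>)"
proof -
  have K: "bij (K s)" using assms by (rule bij_K)
  have "B_mult q l 2 \<omega> \<beta> (M x) (M y) = inv_into UNIV (K s) (P_mult s q l x y)" for x y
    by (metis K K_B_mult bij_is_inj inv_f_f)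
  moreover have "prime_field_linear M" "prime_field_linear (K s)"
    by (rule additive_imp_prime_field_linear, rule M_add)
      (rule additive_imp_prime_field_linear, rule K_add)
  ultimately show ?thesis
    unfolding strongly_isotopic_def
    using bij_M K prime_field_linear_inv bij_imp_bij_inv by metis
qed

end

section \<open>Existence of the constants \<open>i\<close> and \<open>c\<close>, and the
  conclusion\<close>

theorem theorem5p1:
  fixes q l :: nat and \<omega> \<sigma> \<beta> :: "'a::{field,finite}"
  assumes "primepow q" and "odd q" and "q mod 4 = 1"
    and "odd l" and "l > 1"
    and "card (UNIV :: 'a set) = q ^ (2 * l)"
    and "\<omega> \<in> subfield_of_order (q ^ 2) - subfield_of_order q" and "\<omega> ^ q = - \<omega>"
    and "\<sigma> = \<omega> ^ 2"
    and "\<beta> \<in> subfield_of_order (q ^ 2)" and "\<beta> ^ (q + 1) = inverse \<sigma>"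
  shows "commutative_presemifield (P_mult 0 q l :: 'a \<Rightarrow> 'a \<Rightarrow> 'a) \<and>
    commutative_presemifield (B_mult q l 2 \<omega> \<beta>) \<and>
    strongly_isotopic (P_mult 0 q l) (B_mult q l 2 \<omega> \<beta>) \<and>
    (commutative_presemifield (P_mult 1 q l :: 'a \<Rightarrow> 'a \<Rightarrow> 'a) \<longrightarrow>
      strongly_isotopic (P_mult 1 q l) (B_mult q l 2 \<omega> \<beta>))"
proof -
  interpret conjugate_field q l "\<lambda>x::'a. x ^ (q ^ l)" "\<lambda>x::'a. x ^ (q ^ 2)"
    using assms by unfold_locales auto
  have q1: "q > 1" using assms(1) by (rule primepow_gt_Suc_0[unfolded One_nat_def[symmetric]])
  have frob_fixed: "x ^ (q ^ n) = x" if "x ^ q = x" for x :: 'a and n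
    by (induction n) (simp_all add: that power_mult)
  have omega: "\<omega> \<noteq> 0"
    using assms(7) q1 by (auto simp: subfield_of_order_def zero_power)
  hence beta: "\<beta> \<noteq> 0" using assms(9,11) by auto
  \<comment> \<open>This parity makes \<open>- 1\<close> a square in the field of order
    \<open>q\<close>, and later \<open>e\<close> a square in the field of order
    \<open>q ^ 2\<close>.\<close>
  have half: "even ((q - 1) div 2)"
  proof -
    obtain m where "q = 4 * m + 1" using assms(3) by (metis mod_div_decomp mult.commute)
    thus ?thesis by simp
  qed
  have "(- 1 :: 'a) ^ ((q - 1) div 2) = 1" using half by simp
  then obtain i :: 'a where i: "i ^ 2 = - 1" "i ^ q = i"
    using subfield_square_root[of q "2 * l" "- 1 :: 'a"] assms(2,6) q1 by blast
  define e where "e = 1 / (\<beta> * \<omega>)"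
  have "e ^ (q + 1) = 1 / (\<beta> ^ (q + 1) * (\<omega> ^ q * \<omega>))"
    by (simp add: e_def power_divide power_mult_distrib)
  also have "\<dots> = - 1"
    unfolding assms(8,9,11) using omega by (simp add: power2_eq_square field_simps)
  finally have e: "e ^ (q + 1) = - 1" .
  \<comment> \<open>The exponent is \<open>(q + 1) * ((q - 1) div 2)\<close>, so the power is an
    even power of the norm \<open>- 1\<close>.\<close>
  have "e ^ ((q ^ 2 - 1) div 2) = 1"
  proof -
    have "2 dvd q - 1" using assms(2) by simp
    then obtain h where h: "q - 1 = 2 * h" by (rule dvdE)
    have "q ^ 2 - 1 = (q + 1) * (q - 1)" using q1 by (simp add: power2_eq_square algebra_simps)
    also have "\<dots> = 2 * ((q + 1) * h)" unfolding h by simp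
    finally have "q ^ 2 - 1 = 2 * ((q + 1) * h)" .
    hence "(q ^ 2 - 1) div 2 = (q + 1) * ((q - 1) div 2)" unfolding h by simp
    thus ?thesis using half by (simp only: power_mult e) simp
  qed
  moreover have "card (UNIV :: 'a set) = (q ^ 2) ^ l" using assms(6) by (simp add: power_mult)
  moreover have "q ^ 2 > 1" using q1 by (rule one_less_power) simp
  ultimately obtain c where c: "c ^ 2 = e" "c ^ (q ^ 2) = c"
    using subfield_square_root[of "q ^ 2" l e] assms(2) by auto
  \<comment> \<open>As \<open>l\<close> is odd and \<open>\<omega>\<close> is fixed by the
    \<open>q ^ 2\<close> power, only one application of the \<open>q\<close> power remains.\<close>
  have "\<omega> ^ (q ^ l) = - \<omega>"
  proof -
    obtain k where l: "l = 2 * k + 1" using assms(4) by (rule oddE)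
    have w2: "\<omega> ^ (q ^ 2) = \<omega>" using assms(7) by (simp add: subfield_of_order_def)
    have "\<omega> ^ ((q ^ 2) ^ k) = \<omega>" by (induction k) (simp_all add: w2 power_mult)
    hence "\<omega> ^ (q ^ (2 * k)) = \<omega>" by (simp add: power_mult)
    hence "(\<omega> ^ (q ^ (2 * k))) ^ (q ^ 1) = - \<omega>" by (simp add: assms(8))
    thus ?thesis by (simp only: l frob_frob)
  qed
  moreover have "\<beta> * (c * c) * \<omega> = 1"
    using c(1) beta omega by (simp add: e_def power2_eq_square)
  moreover have "i * i = - 1" using i(1) by (simp add: power2_eq_square)
  ultimately interpret isotopism q l "\<lambda>x::'a. x ^ (q ^ l)" "\<lambda>x::'a. x ^ (q ^ 2)" \<omega> \<beta> i c
    using omega i c frob_fixed by unfold_locales auto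
  show ?thesis
    using presemifield_P_mult[OF assms(5)] presemifield_B_mult strongly_isotopic_P_B
    by (simp add: commutative_presemifield_def)
qed

end
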